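(* Let $\mathfrak{g}$ be a Lie algebra over a field $\mathbf{k}$, $\mathfrak{h}$ a toral subalgebra of $\mathfrak{g}$, and $M$ a $\mathfrak{g}$-module on which $\mathfrak{h}$ also acts torally. For each $n$ and $r$ let $\mathcal{F}_rC^n(\mathfrak{g},M)_{\mathbf 0}$ be the set of those cochains $F\in C^n(\mathfrak{g},M)$ of weight $\mathbf 0$ which vanish whenever $r$ or more of their arguments lie in $\mathfrak{h}$. Then $$\delta\,\mathcal{F}_rC^n(\mathfrak{g},M)_{\mathbf 0}\;\subset\;\mathcal{F}_rC^{n+1}(\mathfrak{g},M)_{\mathbf 0}.$$
   Context: A Lie algebra acts torally on a $\mathbf{k}$-vector space if each of its elements acts semisimply, i.e. can be brought into diagonal form over the algebraic closure of $\mathbf{k}$; a subalgebra $\mathfrak{h}$ of $\mathfrak{g}$ is toral if its adjoint action on $\mathfrak{g}$ is toral (it is then Abelian). $C^n(\mathfrak{g},M)$ is the space of alternating $n$-linear maps $\mathfrak{g}^n\to M$, with Chevalley–Eilenberg coboundary $$(\delta F)(g_0,\dots,g_n)=\sum_{i}(-1)^i[g_i,F(\dots,\hat g_i,\dots)]+\sum_{i<j}(-1)^{i+j}F([g_i,g_j],g_0,\dots,\hat g_i,\dots,\hat g_j,\dots,g_n),$$ where $[g,m]$ denotes the action of $g\in\mathfrak{g}$ on $m\in M$. A cochain $F$ has weight $\mathbf 0$ if it is invariant under $\mathfrak{h}$, i.e. $[h,F(g_1,\dots,g_n)]=\sum_{i=1}^n F(g_1,\dots,[h,g_i],\dots,g_n)$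 for all $h\in\mathfrak{h}$ and $g_i\in\mathfrak{g}$.
   Formalization: That the toral subalgebra h is Abelian is made part of its definition: over a field that is not algebraically closed elementwise semisimplicity does not imply it, and the claim then fails (g = h = M = so(3) over the reals, F = id, n = 1, r = 2). *)

theory Defs
  imports "HOL-Algebra.Algebraic_Closure_Type" "HOL-Library.Poly_Mapping"
begin

section \<open>Lie algebras and modules over a field\<close>

locale lie_algebra = vector_space scale
  for scale :: "'k::field \<Rightarrow> 'g::ab_group_add \<Rightarrow> 'g" +
  fixes bracket :: "'g \<Rightarrow> 'g \<Rightarrow> 'g"
  assumes linear_bracket_left: "Vector_Spaces.linear scale scale (\<lambda>x. bracket x y)"
    and linear_bracket_right: "Vector_Spaces.linear scale scale (\<lambda>y. bracket x y)"
    and bracket_self: "bracket x x = 0"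
    and jacobi: "bracket x (bracket y z) + bracket y (bracket z x) + bracket z (bracket x y) = 0"

locale lie_module = lie_algebra scale bracket + M: vector_space scaleM
  for scale :: "'k::field \<Rightarrow> 'g::ab_group_add \<Rightarrow> 'g"
    and bracket :: "'g \<Rightarrow> 'g \<Rightarrow> 'g"
    and scaleM :: "'k \<Rightarrow> 'm::ab_group_add \<Rightarrow> 'm" +
  fixes act :: "'g \<Rightarrow> 'm \<Rightarrow> 'm"
  assumes linear_act_left: "Vector_Spaces.linear scale scaleM (\<lambda>x. act x m)"
    and linear_act_right: "Vector_Spaces.linear scaleM scaleM (\<lambda>m. act x m)"
    and act_bracket: "act (bracket x y) m = act x (act y m) - act y (act x m)"

definition lie_subalgebra ::
    "('k::field \<Rightarrow> 'g::ab_group_add \<Rightarrow> 'g) \<Rightarrow> ('g \<Rightarrow> 'g \<Rightarrow> 'g) \<Rightarrow> 'g set \<Rightarrow> bool" where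
  "lie_subalgebra scale bracket H \<longleftrightarrow>
     module.subspace scale H \<and> (\<forall>x\<in>H. \<forall>y\<in>H. bracket x y \<in> H)"


section \<open>Semisimple operators and toral actions\<close>

text \<open>
  For a basis \<open>B\<close> of a vector space \<open>V\<close> over \<open>k\<close>, the extension of scalars of \<open>V\<close> to the
  algebraic closure of \<open>k\<close> is realised as the space of finitely supported functions
  from \<open>B\<close> to the closure; \<open>ext_vec\<close> is the canonical map from \<open>V\<close> into it, and
  \<open>ext_op\<close> the linear extension of an operator of \<open>V\<close>.  The dimension may be infinite.
\<close>

abbreviation pm_scale :: "'c::field \<Rightarrow> ('b \<Rightarrow>\<^sub>0 'c) \<Rightarrow> ('b \<Rightarrow>\<^sub>0 'c)" where
  "pm_scale c w \<equiv> Poly_Mapping.map (\<lambda>a. c * a) w"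

definition ext_space :: "'v set \<Rightarrow> ('v \<Rightarrow>\<^sub>0 'k::field alg_closure) set" where
  "ext_space B = {w. Poly_Mapping.keys w \<subseteq> B}"

definition ext_vec ::
    "('k::field \<Rightarrow> 'v::ab_group_add \<Rightarrow> 'v) \<Rightarrow> 'v set \<Rightarrow> 'v \<Rightarrow> ('v \<Rightarrow>\<^sub>0 'k alg_closure)" where
  "ext_vec scale B v = Abs_poly_mapping (\<lambda>b. to_ac (module.representation scale B v b))"

definition ext_op ::
    "('k::field \<Rightarrow> 'v::ab_group_add \<Rightarrow> 'v) \<Rightarrow> 'v set \<Rightarrow> ('v \<Rightarrow> 'v) \<Rightarrow>
     ('v \<Rightarrow>\<^sub>0 'k alg_closure) \<Rightarrow> ('v \<Rightarrow>\<^sub>0 'k alg_closure)" where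
  "ext_op scale B T w =
     (\<Sum>b\<in>Poly_Mapping.keys w. pm_scale (Poly_Mapping.lookup w b) (ext_vec scale B (T b)))"

definition semisimple_operator ::
    "('k::field \<Rightarrow> 'v::ab_group_add \<Rightarrow> 'v) \<Rightarrow> ('v \<Rightarrow> 'v) \<Rightarrow> bool" where
  "semisimple_operator scale T \<longleftrightarrow>
     (\<exists>B E. \<not> module.dependent scale B \<and> module.span scale B = UNIV \<and>
            \<not> module.dependent pm_scale E \<and> module.span pm_scale E = ext_space B \<and>
            (\<forall>e\<in>E. \<exists>a. ext_op scale B T e = pm_scale a e))"

definition acts_torally ::
    "('k::field \<Rightarrow> 'v::ab_group_add \<Rightarrow> 'v) \<Rightarrow> ('g \<Rightarrow> 'v \<Rightarrow> 'v) \<Rightarrow> 'g set \<Rightarrow> bool" where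
  "acts_torally scale act H \<longleftrightarrow> (\<forall>h\<in>H. semisimple_operator scale (act h))"

text \<open>
  That a toral subalgebra is Abelian is part of the definition.  Over an algebraically
  closed field this clause is redundant (lemma \<open>acts_torally_imp_abelian\<close> below), but
  in general semisimplicity of the elements does not imply it:
  in the real Lie algebra \<open>so(3)\<close> every \<open>ad x\<close> is diagonalisable over the complex numbers.
  With \<open>g = h = M = so(3)\<close> and \<open>F\<close> the identity map, a \<open>1\<close>-cochain of weight zero, one has
  \<open>\<delta>F(x, y) = [x, y]\<close>, so \<open>\<delta>\<close> would not preserve the filtration for \<open>r = 2\<close>.
\<close>

definition toral_subalgebra ::
    "('k::field \<Rightarrow> 'g::ab_group_add \<Rightarrow> 'g) \<Rightarrow> ('g \<Rightarrow> 'g \<Rightarrow> 'g) \<Rightarrow> 'g set \<Rightarrow> bool" where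
  "toral_subalgebra scale bracket H \<longleftrightarrow>
     lie_subalgebra scale bracket H \<and> acts_torally scale bracket H \<and>
     (\<forall>x\<in>H. \<forall>y\<in>H. bracket x y = 0)"


section \<open>Toral subalgebras over algebraically closed fields are Abelian\<close>

lemma lookup_map_0:
  "f 0 = 0 \<Longrightarrow> Poly_Mapping.lookup (Poly_Mapping.map f w) b = f (Poly_Mapping.lookup w b)"
  by (simp add: Poly_Mapping.map.rep_eq when_def)

lemma lookup_pm_scale [simp]:
  "Poly_Mapping.lookup (pm_scale c w) b = c * Poly_Mapping.lookup w b"
  by (rule lookup_map_0) simp

lemma vector_space_pm_scale: "vector_space (pm_scale :: 'c::field \<Rightarrow> ('b \<Rightarrow>\<^sub>0 'c) \<Rightarrow> _)"
  by unfold_locales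
    (auto intro!: poly_mapping_eqI simp: lookup_map_0 lookup_add algebra_simps)

lemma surj_to_ac: "surj (to_ac :: 'k::alg_closed_field \<Rightarrow> _)"
proof -
  have "x \<in> range to_ac"
    if "p \<noteq> 0" "poly (map_poly to_ac p) x = 0" for p :: "'k poly" and x
    using that
  proof (induction "Polynomial.degree p" arbitrary: p rule: less_induct)
    case less
    show ?case
    proof (cases "Polynomial.degree p = 0")
      case True
      then obtain c where "p = [:c:]" by (metis degree_eq_zeroE)
      with less.prems show ?thesis by (auto simp: map_poly_pCons)
    next
      case False
      then obtain a where a: "poly p a = 0"
        using alg_closed_imp_poly_has_root by blast
      then obtain q where q: "p = [:-a, 1:] * q" by (auto simp: poly_eq_0_iff_dvd)
      have q0: "q \<noteq> 0" using q less.prems by auto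
      have "Polynomial.degree p = Suc (Polynomial.degree q)"
        using q0 unfolding q by (subst degree_mult_eq) auto
      moreover have "map_poly to_ac p = [:- to_ac a, 1:] * map_poly to_ac q"
        unfolding q
        by (rule poly_eqI) (auto simp: coeff_map_poly coeff_pCons split: nat.splits)
      then have "poly (map_poly to_ac p) x = (x - to_ac a) * poly (map_poly to_ac q) x"
        by (simp only: poly_mult) simp
      then have "(x - to_ac a) * poly (map_poly to_ac q) x = 0"
        using less.prems(2) by simp
      then have "x = to_ac a \<or> poly (map_poly to_ac q) x = 0" by simp
      ultimately show ?thesis using less.hyps[of q] q0 by auto
    qed
  qed
  then show ?thesis by (metis alg_closure_algebraic surj_def rangeE)
qed

context vector_space
begin

lemma invariant_subspace_eigen_components:
  assumes T: "Vector_Spaces.linear scale scale T"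
    and W: "subspace W" and inv: "\<And>w. w \<in> W \<Longrightarrow> T w \<in> W"
    and A: "finite A"
  shows "(\<And>a. a \<in> A \<Longrightarrow> T (u a) = a *s u a) \<Longrightarrow> (\<Sum>a\<in>A. u a) \<in> W \<Longrightarrow> (\<forall>a\<in>A. u a \<in> W)"
  using A
proof (induction A arbitrary: u rule: finite_induct)
  case empty
  then show ?case by simp
next
  case (insert c A)
  interpret T: Vector_Spaces.linear scale scale T by (rule T)
  let ?v = "u c + (\<Sum>a\<in>A. u a)"
  have v: "?v \<in> W" using insert by simp
  have "T ?v - c *s ?v = (\<Sum>a\<in>A. (a - c) *s u a)"
    using insert
    by (simp add: T.add T.sum scale_right_distrib scale_sum_right scale_left_diff_distrib
        sum_subtractf)
  moreover have "T ?v - c *s ?v \<in> W"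
    by (intro subspace_diff subspace_scale W v inv)
  ultimately have "(\<Sum>a\<in>A. (a - c) *s u a) \<in> W" by simp
  moreover have "T ((a - c) *s u a) = a *s ((a - c) *s u a)" if "a \<in> A" for a
    using insert.prems(1)[of a] that by (simp add: T.scale mult.commute)
  ultimately have *: "\<forall>a\<in>A. (a - c) *s u a \<in> W"
    using insert.IH[of "\<lambda>a. (a - c) *s u a"] by blast
  have A: "u a \<in> W" if "a \<in> A" for a
  proof -
    have "a \<noteq> c" using that insert by auto
    moreover have "inverse (a - c) *s ((a - c) *s u a) \<in> W"
      by (rule subspace_scale[OF W]) (use * that in blast)
    ultimately show ?thesis by simp
  qed
  then have "(\<Sum>a\<in>A. u a) \<in> W" using W by (simp add: subspace_sum)
  then have "?v - (\<Sum>a\<in>A. u a) \<in> W" by (intro subspace_diff W v)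
  then have "u c \<in> W" by simp
  then show ?case using A by auto
qed

lemma span_eigen_decomposition:
  assumes T: "Vector_Spaces.linear scale scale T"
    and v: "v \<in> span {v. \<exists>a. T v = a *s v}"
  shows "\<exists>A u. finite A \<and> (\<forall>a. T (u a) = a *s u a) \<and> v = (\<Sum>a\<in>A. u a)"
proof -
  interpret T: Vector_Spaces.linear scale scale T by (rule T)
  define P where "P v \<longleftrightarrow> (\<exists>A u. finite A \<and> (\<forall>a. a \<notin> A \<longrightarrow> u a = 0) \<and>
    (\<forall>a. T (u a) = a *s u a) \<and> v = (\<Sum>a\<in>A. u a))" for v
  have eig: "P v" if "T v = a *s v" for a v
    unfolding P_def
    by (rule exI[of _ "{a}"], rule exI[of _ "\<lambda>b. if b = a then v else 0"]) (use that in auto)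
  have sub: "subspace (Collect P)"
  proof (rule subspaceI)
    show "0 \<in> Collect P" using eig[of 0 0] by simp
  next
    fix x y assume "x \<in> Collect P" "y \<in> Collect P"
    then obtain A u A' u' where
      1: "finite A" "\<forall>a. a \<notin> A \<longrightarrow> u a = 0" "\<forall>a. T (u a) = a *s u a" "x = (\<Sum>a\<in>A. u a)" and
      2: "finite A'" "\<forall>a. a \<notin> A' \<longrightarrow> u' a = 0" "\<forall>a. T (u' a) = a *s u' a" "y = (\<Sum>a\<in>A'. u' a)"
      unfolding P_def by blast
    have "x = (\<Sum>a\<in>A\<union>A'. u a)" unfolding 1(4) by (rule sum.mono_neutral_left) (use 1 2 in auto)
    moreover have "y = (\<Sum>a\<in>A\<union>A'. u' a)"
      unfolding 2(4) by (rule sum.mono_neutral_left) (use 1 2 in auto)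
    ultimately have "x + y = (\<Sum>a\<in>A\<union>A'. u a + u' a)" by (simp add: sum.distrib)
    then show "x + y \<in> Collect P"
      unfolding P_def mem_Collect_eq
      by (intro exI[of _ "A \<union> A'"] exI[of _ "\<lambda>a. u a + u' a"])
        (use 1 2 in \<open>auto simp: T.add scale_right_distrib\<close>)
  next
    fix c x assume "x \<in> Collect P"
    then obtain A u where
      1: "finite A" "\<forall>a. a \<notin> A \<longrightarrow> u a = 0" "\<forall>a. T (u a) = a *s u a" "x = (\<Sum>a\<in>A. u a)"
      unfolding P_def by blast
    then show "c *s x \<in> Collect P"
      unfolding P_def mem_Collect_eq
      by (intro exI[of _ A] exI[of _ "\<lambda>a. c *s u a"])
        (auto simp: T.scale scale_sum_right mult.commute)
  qed
  have "P v"
    using v span_minimal[OF _ sub, of "{v. \<exists>a. T v = a *s v}"] eig by blast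
  then show ?thesis unfolding P_def by blast
qed

end

lemma semisimple_imp_span_eigenvectors:
  fixes scale :: "'k::alg_closed_field \<Rightarrow> 'v::ab_group_add \<Rightarrow> 'v"
  assumes V: "vector_space scale" and T: "Vector_Spaces.linear scale scale T"
    and ss: "semisimple_operator scale T"
  shows "module.span scale {v. \<exists>a. T v = scale a v} = UNIV"
proof -
  interpret vector_space scale by (rule V)
  interpret T: Vector_Spaces.linear scale scale T by (rule T)
  interpret W: vector_space "pm_scale :: _ \<Rightarrow> ('v \<Rightarrow>\<^sub>0 'k alg_closure) \<Rightarrow> _"
    by (rule vector_space_pm_scale)
  obtain B E where B: "independent B" "span B = UNIV" and
    E: "W.span E = ext_space B" "\<And>e. e \<in> E \<Longrightarrow> \<exists>a. ext_op scale B T e = pm_scale a e"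
    using ss unfolding semisimple_operator_def by blast
  have of_to[simp]: "to_ac (of_ac x) = x" for x :: "'k alg_closure"
    by (rule to_ac_of_ac) (simp add: surj_to_ac)
  have of_add: "of_ac (x + y) = of_ac x + of_ac y" for x y :: "'k alg_closure"
    by (rule of_ac_eqI) simp
  have of_mult: "of_ac (x * y) = of_ac x * of_ac y" for x y :: "'k alg_closure"
    by (rule of_ac_eqI) simp
  define \<psi> :: "('v \<Rightarrow>\<^sub>0 'k alg_closure) \<Rightarrow> 'v" where
    "\<psi> w = (\<Sum>b\<in>Poly_Mapping.keys w. scale (of_ac (Poly_Mapping.lookup w b)) b)" for w
  have psi: "\<psi> w = (\<Sum>b\<in>S. scale (of_ac (Poly_Mapping.lookup w b)) b)"
    if "finite S" "Poly_Mapping.keys w \<subseteq> S" for w S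
    unfolding \<psi>_def by (rule sum.mono_neutral_left) (use that in \<open>auto simp: in_keys_iff\<close>)
  have psi_add: "\<psi> (v + w) = \<psi> v + \<psi> w" for v w
  proof -
    let ?S = "Poly_Mapping.keys v \<union> Poly_Mapping.keys w"
    have "Poly_Mapping.keys (v + w) \<subseteq> ?S" by (rule Poly_Mapping.keys_add)
    then show ?thesis
      by (simp add: psi[of ?S] lookup_add of_add scale_left_distrib sum.distrib)
  qed
  have psi_scale: "\<psi> (pm_scale a w) = scale (of_ac a) (\<psi> w)" for a w
  proof -
    have "Poly_Mapping.keys (pm_scale a w) \<subseteq> Poly_Mapping.keys w" by (auto simp: in_keys_iff)
    then show ?thesis
      by (simp add: psi[of "Poly_Mapping.keys w"] of_mult scale_sum_right)
  qed
  have psi_0: "\<psi> 0 = 0" by (simp add: \<psi>_def)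
  have psi_sum: "\<psi> (\<Sum>i\<in>I. f i) = (\<Sum>i\<in>I. \<psi> (f i))" for f and I :: "'v set"
    by (induction I rule: infinite_finite_induct) (auto simp: psi_0 psi_add)
  have fin: "finite {b. to_ac (representation B v b) \<noteq> 0}" for v
    by (simp add: finite_representation)
  have lookup_ext: "Poly_Mapping.lookup (ext_vec scale B v) b = to_ac (representation B v b)" for v b
    unfolding ext_vec_def using fin by (simp add: lookup_Abs_poly_mapping)
  have keys_ext: "Poly_Mapping.keys (ext_vec scale B v) = {b. representation B v b \<noteq> 0}" for v
    by (auto simp: in_keys_iff lookup_ext)
  have psi_ext: "\<psi> (ext_vec scale B v) = v" for v
    unfolding \<psi>_def keys_ext lookup_ext
    using sum_nonzero_representation_eq[OF B(1), of v] B(2) by simp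
  have psi_op: "\<psi> (ext_op scale B T w) = T (\<psi> w)" for w
    unfolding ext_op_def psi_sum psi_scale psi_ext
    by (simp add: \<psi>_def T.sum T.scale)
  let ?S = "{v. \<exists>a. T v = scale a v}"
  have eig: "\<psi> e \<in> ?S" if "e \<in> E" for e
    using E(2)[OF that] psi_op[of e] psi_scale by (metis (mono_tags, lifting) mem_Collect_eq)
  have "v \<in> span ?S" for v
  proof -
    have "W.span E \<subseteq> {w. \<psi> w \<in> span ?S}"
    proof (rule W.span_minimal)
      show "E \<subseteq> {w. \<psi> w \<in> span ?S}" using eig span_base by blast
      show "W.subspace {w. \<psi> w \<in> span ?S}"
        by (rule W.subspaceI) (auto simp: psi_0 psi_add psi_scale span_zero span_add span_scale)
    qed
    moreover have "ext_vec scale B v \<in> W.span E"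
      unfolding E ext_space_def using keys_ext representation_ne_zero by auto
    ultimately show ?thesis using psi_ext[of v] by auto
  qed
  then show ?thesis by auto
qed

lemma acts_torally_imp_abelian:
  fixes scale :: "'k::alg_closed_field \<Rightarrow> 'g::ab_group_add \<Rightarrow> 'g"
  assumes "lie_algebra scale bracket" and H: "lie_subalgebra scale bracket H"
    and tor: "acts_torally scale bracket H" and x: "x \<in> H" and y: "y \<in> H"
  shows "bracket x y = 0"
proof -
  interpret lie_algebra scale bracket by fact
  interpret R: Vector_Spaces.linear scale scale "bracket z" for z
    by (rule linear_bracket_right)
  interpret L: Vector_Spaces.linear scale scale "\<lambda>v. bracket v z" for z
    by (rule linear_bracket_left)
  have sub: "subspace H" and closed: "\<And>x y. x \<in> H \<Longrightarrow> y \<in> H \<Longrightarrow> bracket x y \<in> H"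
    using H by (auto simp: lie_subalgebra_def)
  have skew: "bracket a b = - bracket b a" for a b
  proof -
    have "bracket (a + b) (a + b) = bracket a a + bracket b a + (bracket a b + bracket b b)"
      by (simp only: R.add L.add)
    then show ?thesis by (simp add: bracket_self eq_neg_iff_add_eq_0 add.commute)
  qed
  have eig: "v \<in> span {v. \<exists>a. bracket x v = scale a v}" if "x \<in> H" for x v
    using semisimple_imp_span_eigenvectors[OF vector_space_axioms linear_bracket_right, of x]
      tor that by (auto simp: acts_torally_def)
  have ker: "bracket z v = 0" if z: "z \<in> H" and 0: "bracket z (bracket z v) = 0" for z v
  proof -
    obtain A u where u: "finite A" "\<forall>a. bracket z (u a) = scale a (u a)" "v = (\<Sum>a\<in>A. u a)"
      using span_eigen_decomposition[OF linear_bracket_right eig[OF z]] by blast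
    have "(\<Sum>a\<in>A. scale a (scale a (u a))) = 0"
      using 0 unfolding u(3) by (simp add: R.sum R.scale u(2))
    then have "\<forall>a\<in>A. scale a (scale a (u a)) \<in> {0}"
      by (intro invariant_subspace_eigen_components[OF linear_bracket_right[of z] _ _ u(1)])
        (auto simp: R.scale u(2) R.zero)
    then show ?thesis unfolding u(3) by (auto simp: R.sum u(2) intro!: sum.neutral)
  qed
  obtain A u where u: "finite A" "\<forall>a. bracket x (u a) = scale a (u a)" "y = (\<Sum>a\<in>A. u a)"
    using span_eigen_decomposition[OF linear_bracket_right eig[OF x]] by blast
  have "(\<Sum>a\<in>A. u a) \<in> H" using y u(3) by metis
  then have uH: "\<forall>a\<in>A. u a \<in> H"
    using u(2)
    by (intro invariant_subspace_eigen_components[OF linear_bracket_right[of x] sub _ u(1)])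
      (auto intro: closed x)
  have "bracket x (u a) = 0" if "a \<in> A" for a
  proof -
    have "bracket (u a) (bracket (u a) x) = 0"
      using skew[of "u a" x] u(2) by (simp add: R.neg R.scale bracket_self)
    then have "bracket (u a) x = 0" using ker uH that by blast
    then show ?thesis using skew[of x "u a"] by simp
  qed
  then show ?thesis unfolding u(3) by (simp add: R.sum)
qed


section \<open>Cochains\<close>

text \<open>
  An \<open>n\<close>-linear map takes its arguments as a list of length \<open>n\<close>; cochains of degree \<open>n\<close> are
  normalised to be \<open>0\<close> on lists of any other length, so that equality of cochains is
  equality of functions.
\<close>

definition cochains ::
    "('k::field \<Rightarrow> 'g::ab_group_add \<Rightarrow> 'g) \<Rightarrow> ('k \<Rightarrow> 'm::ab_group_add \<Rightarrow> 'm) \<Rightarrow> nat \<Rightarrow>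
     ('g list \<Rightarrow> 'm) set" where
  "cochains scale scaleM n =
     {F. (\<forall>gs. length gs \<noteq> n \<longrightarrow> F gs = 0) \<and>
         (\<forall>gs i. length gs = n \<longrightarrow> i < n \<longrightarrow>
            Vector_Spaces.linear scale scaleM (\<lambda>x. F (gs[i := x]))) \<and>
         (\<forall>gs i j. length gs = n \<longrightarrow> i < j \<longrightarrow> j < n \<longrightarrow> gs ! i = gs ! j \<longrightarrow> F gs = 0)}"

definition omit :: "nat \<Rightarrow> 'a list \<Rightarrow> 'a list" where
  "omit i xs = take i xs @ drop (Suc i) xs"

definition coboundary ::
    "('g \<Rightarrow> 'g \<Rightarrow> 'g) \<Rightarrow> ('k::field \<Rightarrow> 'm::ab_group_add \<Rightarrow> 'm) \<Rightarrow> ('g \<Rightarrow> 'm \<Rightarrow> 'm) \<Rightarrow> nat \<Rightarrow>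
     ('g list \<Rightarrow> 'm) \<Rightarrow> ('g list \<Rightarrow> 'm)" where
  "coboundary bracket scaleM act n F gs =
     (if length gs = Suc n then
        (\<Sum>i\<le>n. scaleM ((-1) ^ i) (act (gs ! i) (F (omit i gs)))) +
        (\<Sum>j\<le>n. \<Sum>i<j. scaleM ((-1) ^ (i + j))
            (F (bracket (gs ! i) (gs ! j) # omit i (omit j gs))))
      else 0)"

definition weight_zero ::
    "('g \<Rightarrow> 'g \<Rightarrow> 'g) \<Rightarrow> ('g \<Rightarrow> 'm::ab_group_add \<Rightarrow> 'm) \<Rightarrow> 'g set \<Rightarrow> nat \<Rightarrow> ('g list \<Rightarrow> 'm) \<Rightarrow> bool"
  where
  "weight_zero bracket act H n F \<longleftrightarrow>
     (\<forall>h\<in>H. \<forall>gs. length gs = n \<longrightarrow>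
        act h (F gs) = (\<Sum>i<n. F (gs[i := bracket h (gs ! i)])))"

definition filtered_cochains ::
    "('k::field \<Rightarrow> 'g::ab_group_add \<Rightarrow> 'g) \<Rightarrow> ('g \<Rightarrow> 'g \<Rightarrow> 'g) \<Rightarrow>
     ('k \<Rightarrow> 'm::ab_group_add \<Rightarrow> 'm) \<Rightarrow> ('g \<Rightarrow> 'm \<Rightarrow> 'm) \<Rightarrow> 'g set \<Rightarrow> nat \<Rightarrow> nat \<Rightarrow>
     ('g list \<Rightarrow> 'm) set" where
  "filtered_cochains scale bracket scaleM act H r n =
     {F \<in> cochains scale scaleM n. weight_zero bracket act H n F \<and>
        (\<forall>gs. length gs = n \<longrightarrow> card {i. i < n \<and> gs ! i \<in> H} \<ge> r \<longrightarrow> F gs = 0)}"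

end

(*
  Write i_x for the insertion of x as first argument and L_x for the Lie derivative of cochains.
  Cartan's formula i_x \<delta> = L_x - \<delta> i_x determines \<delta> by recursion on the degree, and together with
  L_x i_y = i_y L_x + i_[x,y] it shows, by induction on the degree, that \<delta> F is alternating and
  that \<delta> commutes with L_x.  A cochain F has weight zero iff L_h F = 0 for all h in H.  If some
  argument of \<delta> F is an element h of H, it may be moved to the front, and there
  i_h \<delta> F = - \<delta> (i_h F), where i_h F vanishes already on r - 1 arguments from H and
  has again weight zero because H is Abelian; so the filtration claim follows by induction as well.
*)
theory Submission
  imports Defs
begin

context lie_module
begin

section \<open>Linearity of bracket and action; the adjoint representation\<close>

sublocale bracket_left: Vector_Spaces.linear scale scale "\<lambda>x. bracket x y" for y
  by (rule linear_bracket_left)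

sublocale bracket_right: Vector_Spaces.linear scale scale "\<lambda>y. bracket x y" for x
  by (rule linear_bracket_right)

sublocale act_left: Vector_Spaces.linear scale scaleM "\<lambda>x. act x m" for m
  by (rule linear_act_left)

sublocale act_right: Vector_Spaces.linear scaleM scaleM "\<lambda>m. act x m" for x
  by (rule linear_act_right)

lemma bracket_skew: "bracket x y = - bracket y x"
proof -
  have "bracket (x + y) (x + y) = bracket x x + bracket y x + (bracket x y + bracket y y)"
    by (simp only: bracket_left.add bracket_right.add)
  then show ?thesis by (simp add: bracket_self eq_neg_iff_add_eq_0 add.commute)
qed

text \<open>The Jacobi identity in the form that ad is a representation;
  \<open>lie_deriv_bracket\<close> uses it for the bracket with the first argument.\<close>

lemma bracket_bracket_left:
  "bracket (bracket x y) z = bracket x (bracket y z) - bracket y (bracket x z)"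
proof -
  have "bracket (bracket x y) z = bracket x (bracket y z) + bracket y (bracket z x)"
    using jacobi[of x y z] bracket_skew[of z "bracket x y"]
    by (simp add: algebra_simps)
  then show ?thesis
    using bracket_skew[of z x] by (simp add: bracket_right.neg)
qed

section \<open>Alternating forms\<close>

text \<open>
  No degree is fixed here: a cochain of degree \<open>n\<close> is \<open>0\<close> on lists of any other length, so it
  satisfies these conditions on lists of arbitrary length.
\<close>

definition alternating_form :: "('g list \<Rightarrow> 'm) \<Rightarrow> bool" where
  "alternating_form F \<longleftrightarrow>
     (\<forall>ps x y qs. F (ps @ (x + y) # qs) = F (ps @ x # qs) + F (ps @ y # qs)) \<and>
     (\<forall>ps c x qs. F (ps @ scale c x # qs) = scaleM c (F (ps @ x # qs))) \<and>
     (\<forall>ps x qs. F (ps @ x # x # qs) = 0)"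

lemma alternating_form_add:
  "alternating_form F \<Longrightarrow> F (ps @ (x + y) # qs) = F (ps @ x # qs) + F (ps @ y # qs)"
  by (simp add: alternating_form_def)

lemma alternating_form_scale:
  "alternating_form F \<Longrightarrow> F (ps @ scale c x # qs) = scaleM c (F (ps @ x # qs))"
  by (simp add: alternating_form_def)

lemma alternating_form_repeat: "alternating_form F \<Longrightarrow> F (ps @ x # x # qs) = 0"
  by (simp add: alternating_form_def)

lemma alternating_form_0: "alternating_form F \<Longrightarrow> F (ps @ 0 # qs) = 0"
  using alternating_form_add[of F ps 0 0 qs] by simp

lemma alternating_form_diff:
  "alternating_form F \<Longrightarrow> F (ps @ (x - y) # qs) = F (ps @ x # qs) - F (ps @ y # qs)"
  using alternating_form_add[of F ps "x - y" y qs] by (simp add: algebra_simps)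

lemmas alternating_form_Cons =
  alternating_form_add[of _ "[]", simplified]
  alternating_form_scale[of _ "[]", simplified]
  alternating_form_repeat[of _ "[]", simplified]
  alternating_form_0[of _ "[]", simplified]
  alternating_form_diff[of _ "[]", simplified]

text \<open>Lets an induction hypothesis be applied to i_z F once the first argument z has been
  split off.\<close>

lemma alternating_form_insertion: "alternating_form F \<Longrightarrow> alternating_form (\<lambda>zs. F (z # zs))"
  unfolding alternating_form_def by (metis append_Cons)

lemma alternating_form_swap:
  assumes "alternating_form F"
  shows "F (ps @ x # y # qs) = - F (ps @ y # x # qs)"
proof -
  have "F (ps @ (x + y) # (x + y) # qs) = F (ps @ x # (x + y) # qs) + F (ps @ y # (x + y) # qs)"
    by (rule alternating_form_add[OF assms])
  also have "\<dots> = F (ps @ x # y # qs) + F (ps @ y # x # qs)"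
    using alternating_form_add[OF assms, of "ps @ [x]" x y qs]
      alternating_form_add[OF assms, of "ps @ [y]" x y qs]
    by (simp add: alternating_form_repeat[OF assms])
  finally show ?thesis
    by (simp add: alternating_form_repeat[OF assms] eq_neg_iff_add_eq_0)
qed

text \<open>One adjacent transposition for each entry of \<open>qs\<close>. Hence it is enough to
  ask for zeros at adjacent equal arguments, and any argument can be brought to the front.\<close>

lemma alternating_form_move:
  assumes "alternating_form F"
  shows "F (ps @ qs @ x # rs) = scaleM ((-1) ^ length qs) (F (ps @ x # qs @ rs))"
proof (induction qs arbitrary: ps)
  case Nil
  then show ?case by simp
next
  case (Cons q qs)
  show ?case
    using Cons[of "ps @ [q]"] alternating_form_swap[OF assms, of ps q x "qs @ rs"] by simp
qed

lemma cochains_iff_alternating_form: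
  "F \<in> cochains scale scaleM n \<longleftrightarrow> alternating_form F \<and> (\<forall>gs. length gs \<noteq> n \<longrightarrow> F gs = 0)"
proof (intro iffI conjI)
  assume F: "F \<in> cochains scale scaleM n"
  then show 0: "\<forall>gs. length gs \<noteq> n \<longrightarrow> F gs = 0" by (simp add: cochains_def)
  \<comment> \<open>The entry 0 is a placeholder, overwritten by the update at position
    \<open>length ps\<close>; only the length matters.\<close>
  have lin: "Vector_Spaces.linear scale scaleM (\<lambda>x. F (ps @ x # qs))"
    if "length (ps @ 0 # qs) = n" for ps qs
    using F[unfolded cochains_def, simplified, THEN conjunct2, THEN conjunct1, rule_format,
        of "ps @ 0 # qs" "length ps"] that
    by (simp add: list_update_append)
  show "alternating_form F"
    unfolding alternating_form_def
  proof (intro conjI allI)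
    fix ps qs x y c
    show "F (ps @ (x + y) # qs) = F (ps @ x # qs) + F (ps @ y # qs)"
    proof (cases "length (ps @ 0 # qs) = n")
      case True
      interpret l: Vector_Spaces.linear scale scaleM "\<lambda>x. F (ps @ x # qs)" by (rule lin[OF True])
      show ?thesis by (rule l.add)
    qed (simp add: 0)
    show "F (ps @ scale c x # qs) = scaleM c (F (ps @ x # qs))"
    proof (cases "length (ps @ 0 # qs) = n")
      case True
      interpret l: Vector_Spaces.linear scale scaleM "\<lambda>x. F (ps @ x # qs)" by (rule lin[OF True])
      show ?thesis by (rule l.scale)
    qed (simp add: 0)
    show "F (ps @ x # x # qs) = 0"
    proof (cases "length (ps @ x # x # qs) = n")
      case True
      show ?thesis
        using F[unfolded cochains_def, simplified, THEN conjunct2, THEN conjunct2, rule_format,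
            of "ps @ x # x # qs" "length ps" "Suc (length ps)"] True
        by (simp add: nth_append)
    qed (simp add: 0)
  qed
next
  assume "alternating_form F \<and> (\<forall>gs. length gs \<noteq> n \<longrightarrow> F gs = 0)"
  then have F: "alternating_form F" and 0: "\<And>gs. length gs \<noteq> n \<Longrightarrow> F gs = 0" by auto
  have "Vector_Spaces.linear scale scaleM (\<lambda>x. F (gs[i := x]))" if "length gs = n" "i < n" for gs i
    by unfold_locales
      (use that in \<open>simp_all add: upd_conv_take_nth_drop alternating_form_add[OF F]
        alternating_form_scale[OF F]\<close>)
  moreover have "F gs = 0" if "length gs = n" "i < j" "j < n" "gs ! i = gs ! j" for gs i j
  proof -
    \<comment> \<open>Cut \<open>gs\<close> around positions i and j; moving the second of the equal
      entries across \<open>qs\<close> makes them adjacent.\<close>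
    define ps where "ps = take i gs"
    define qs where "qs = take (j - Suc i) (drop (Suc i) gs)"
    define rs where "rs = drop (Suc j) gs"
    have "drop (Suc i) gs = qs @ gs ! j # rs"
      using that id_take_nth_drop[of "j - Suc i" "drop (Suc i) gs"] by (simp add: qs_def rs_def)
    then have "gs = ps @ gs ! i # qs @ gs ! i # rs"
      using that id_take_nth_drop[of i gs] by (simp add: ps_def)
    then show ?thesis
      using alternating_form_move[OF F, of "ps @ [gs ! i]" qs "gs ! i" rs]
        alternating_form_repeat[OF F, of ps "gs ! i" "qs @ rs"] by simp
  qed
  ultimately show "F \<in> cochains scale scaleM n"
    using 0 by (auto simp: cochains_def)
qed

section \<open>The Lie derivative\<close>

text \<open>The second equation is \<open>i_y L_x = L_x i_y - i_[x,y]\<close>.\<close>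

fun lie_deriv :: "'g \<Rightarrow> ('g list \<Rightarrow> 'm) \<Rightarrow> 'g list \<Rightarrow> 'm" where
  "lie_deriv x F [] = act x (F [])"
| "lie_deriv x F (y # gs) = lie_deriv x (\<lambda>zs. F (y # zs)) gs - F (bracket x y # gs)"

text \<open>This closed form yields linearity in \<open>F\<close> and the comparison with
  \<open>weight_zero\<close>; the recursion serves the inductions.\<close>

lemma lie_deriv_eq:
  "lie_deriv x F gs = act x (F gs) - (\<Sum>i<length gs. F (gs[i := bracket x (gs ! i)]))"
  by (induction gs arbitrary: F) (simp_all add: sum.lessThan_Suc_shift del: sum.lessThan_Suc)

lemma lie_deriv_form_0 [simp]: "lie_deriv x (\<lambda>_. 0) gs = 0"
  by (simp add: lie_deriv_eq act_right.zero)

lemma lie_deriv_form_add: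
  "lie_deriv x (\<lambda>zs. F zs + G zs) gs = lie_deriv x F gs + lie_deriv x G gs"
  by (simp add: lie_deriv_eq act_right.add sum.distrib)

lemma lie_deriv_form_diff:
  "lie_deriv x (\<lambda>zs. F zs - G zs) gs = lie_deriv x F gs - lie_deriv x G gs"
  by (simp add: lie_deriv_eq act_right.diff sum_subtractf)

lemma lie_deriv_form_scale:
  "lie_deriv x (\<lambda>zs. scaleM c (F zs)) gs = scaleM c (lie_deriv x F gs)"
  by (simp add: lie_deriv_eq act_right.scale M.scale_right_diff_distrib M.scale_sum_right)

text \<open>As x also enters through arguments [x, g] of \<open>F\<close>, additivity in x rests on
  that of \<open>F\<close>. It is what makes \<open>cobd F\<close> additive in its first
  argument.\<close>

lemma lie_deriv_add:
  "alternating_form F \<Longrightarrow> lie_deriv (x + y) F gs = lie_deriv x F gs + lie_deriv y F gs"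
proof (induction gs arbitrary: F)
  case (Cons g gs)
  show ?case
    using Cons.IH[OF alternating_form_insertion[OF Cons.prems]] Cons.prems
    by (simp add: bracket_left.add alternating_form_Cons[OF Cons.prems])
qed (simp add: act_left.add)

lemma lie_deriv_scale:
  "alternating_form F \<Longrightarrow> lie_deriv (scale c x) F gs = scaleM c (lie_deriv x F gs)"
proof (induction gs arbitrary: F)
  case (Cons g gs)
  show ?case
    using Cons.IH[OF alternating_form_insertion[OF Cons.prems]] Cons.prems
    by (simp add: bracket_left.scale alternating_form_Cons[OF Cons.prems]
        M.scale_right_diff_distrib)
qed (simp add: act_left.scale)

text \<open>Induction on the prefix: a leading p gives a term in i_p F, covered by the induction
  hypothesis, and a term with [x, p] in front, where the law for \<open>F\<close> applies.\<close>

lemma alternating_form_lie_deriv: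
  assumes "alternating_form F"
  shows "alternating_form (lie_deriv x F)"
  unfolding alternating_form_def
proof (intro conjI allI)
  fix ps qs y z c
  show "lie_deriv x F (ps @ (y + z) # qs) = lie_deriv x F (ps @ y # qs) + lie_deriv x F (ps @ z # qs)"
    using assms
  proof (induction ps arbitrary: F)
    case Nil
    then show ?case by (simp add: alternating_form_Cons[OF Nil] lie_deriv_form_add bracket_right.add)
  next
    case (Cons p ps)
    show ?case
      using Cons.IH[OF alternating_form_insertion[OF Cons.prems]]
        alternating_form_add[OF Cons.prems, of "bracket x p # ps"] by simp
  qed
  show "lie_deriv x F (ps @ scale c y # qs) = scaleM c (lie_deriv x F (ps @ y # qs))"
    using assms
  proof (induction ps arbitrary: F)
    case Nil
    then show ?case
      by (simp add: alternating_form_Cons[OF Nil] lie_deriv_form_scale bracket_right.scale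
          M.scale_right_diff_distrib)
  next
    case (Cons p ps)
    show ?case
      using Cons.IH[OF alternating_form_insertion[OF Cons.prems]]
        alternating_form_scale[OF Cons.prems, of "bracket x p # ps"]
      by (simp add: M.scale_right_diff_distrib)
  qed
  show "lie_deriv x F (ps @ y # y # qs) = 0"
    using assms
  proof (induction ps arbitrary: F)
    case Nil
    \<comment> \<open>The two terms with one y replaced by [x, y] cancel by skew symmetry; the
      remaining one contains y twice.\<close>
    then show ?case
      using alternating_form_swap[of F "[]" y "bracket x y" qs]
      by (simp add: alternating_form_Cons[OF Nil])
  next
    case (Cons p ps)
    show ?case
      using Cons.IH[OF alternating_form_insertion[OF Cons.prems]]
        alternating_form_repeat[OF Cons.prems, of "bracket x p # ps"] by simp
  qed
qed

text \<open>At the empty list this is the module axiom. At a first argument g the mixed terms L_x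
  i_[y,g] F and L_y i_[x,g] F cancel in the commutator, and the double brackets match by
  Jacobi.\<close>

lemma lie_deriv_bracket:
  "alternating_form F \<Longrightarrow>
    lie_deriv (bracket x y) F gs = lie_deriv x (lie_deriv y F) gs - lie_deriv y (lie_deriv x F) gs"
proof (induction gs arbitrary: F)
  case Nil
  then show ?case by (simp add: act_bracket)
next
  case (Cons g gs)
  show ?case
    using Cons.IH[OF alternating_form_insertion[OF Cons.prems]] Cons.prems
    by (simp add: lie_deriv_form_diff bracket_bracket_left alternating_form_Cons[OF Cons.prems])
qed

section \<open>The coboundary by recursion\<close>

text \<open>The second equation is Cartan's formula \<open>i_x \<delta> = L_x - \<delta> i_x\<close>.\<close>

fun cobd :: "('g list \<Rightarrow> 'm) \<Rightarrow> 'g list \<Rightarrow> 'm" where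
  "cobd F [] = 0"
| "cobd F (x # gs) = lie_deriv x F gs - cobd (\<lambda>zs. F (x # zs)) gs"

lemma cobd_form_0 [simp]: "cobd (\<lambda>_. 0) gs = 0"
  by (induction gs) simp_all

lemma cobd_form_add: "cobd (\<lambda>zs. F zs + G zs) gs = cobd F gs + cobd G gs"
  by (induction gs arbitrary: F G) (simp_all add: lie_deriv_form_add)

lemma cobd_form_diff: "cobd (\<lambda>zs. F zs - G zs) gs = cobd F gs - cobd G gs"
  by (induction gs arbitrary: F G) (simp_all add: lie_deriv_form_diff)

lemma cobd_form_scale: "cobd (\<lambda>zs. scaleM c (F zs)) gs = scaleM c (cobd F gs)"
  by (induction gs arbitrary: F) (simp_all add: lie_deriv_form_scale M.scale_right_diff_distrib)

lemma alternating_form_cobd: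
  assumes "alternating_form F"
  shows "alternating_form (cobd F)"
  unfolding alternating_form_def
proof (intro conjI allI)
  fix ps qs y z c
  show "cobd F (ps @ (y + z) # qs) = cobd F (ps @ y # qs) + cobd F (ps @ z # qs)"
    using assms
  proof (induction ps arbitrary: F)
    case Nil
    then show ?case by (simp add: alternating_form_Cons[OF Nil] lie_deriv_add cobd_form_add)
  next
    case (Cons p ps)
    show ?case
      using Cons.IH[OF alternating_form_insertion[OF Cons.prems]]
        alternating_form_add[OF alternating_form_lie_deriv[OF Cons.prems]] by simp
  qed
  show "cobd F (ps @ scale c y # qs) = scaleM c (cobd F (ps @ y # qs))"
    using assms
  proof (induction ps arbitrary: F)
    case Nil
    then show ?case
      by (simp add: alternating_form_Cons[OF Nil] lie_deriv_scale cobd_form_scale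
          M.scale_right_diff_distrib)
  next
    case (Cons p ps)
    show ?case
      using Cons.IH[OF alternating_form_insertion[OF Cons.prems]]
        alternating_form_scale[OF alternating_form_lie_deriv[OF Cons.prems]]
      by (simp add: M.scale_right_diff_distrib)
  qed
  show "cobd F (ps @ y # y # qs) = 0"
    using assms
  proof (induction ps arbitrary: F)
    case Nil
    \<comment> \<open>Applying the recursion twice gives L_y i_y F with both signs; what is left
      contains [y, y] or y twice.\<close>
    then show ?case by (simp add: alternating_form_Cons[OF Nil] bracket_self)
  next
    case (Cons p ps)
    show ?case
      using Cons.IH[OF alternating_form_insertion[OF Cons.prems]]
        alternating_form_repeat[OF alternating_form_lie_deriv[OF Cons.prems]] by simp
  qed
qed

text \<open>Expanded at a first argument g, the two sides differ by L_x L_g F - L_g L_x F - L_[x,g]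
  F, which is 0, and by the same claim for i_g F.\<close>

lemma lie_deriv_cobd:
  "alternating_form F \<Longrightarrow> lie_deriv x (cobd F) gs = cobd (lie_deriv x F) gs"
proof (induction gs arbitrary: F)
  case Nil
  then show ?case by (simp add: act_right.zero)
next
  case (Cons g gs)
  show ?case
    using Cons.IH[OF alternating_form_insertion[OF Cons.prems]] Cons.prems
    by (simp add: lie_deriv_form_diff cobd_form_diff lie_deriv_bracket)
qed

text \<open>The recursion evaluates \<open>F\<close> only on lists one entry shorter than
  \<open>gs\<close>. This settles the lists of wrong length and the coboundary of a zero
  form.\<close>

lemma cobd_eq_0:
  "(\<And>zs. Suc (length zs) = length gs \<Longrightarrow> F zs = 0) \<Longrightarrow> cobd F gs = 0"
proof (induction gs arbitrary: F)
  case (Cons g gs)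
  have "cobd (\<lambda>zs. F (g # zs)) gs = 0" by (rule Cons.IH) (simp add: Cons.prems)
  then show ?case by (simp add: lie_deriv_eq Cons.prems act_right.zero)
qed simp

section \<open>Agreement of the recursion with the Chevalley-Eilenberg formula\<close>

lemma omit_Cons [simp]: "omit 0 (x # xs) = xs" "omit (Suc i) (x # xs) = x # omit i xs"
  by (simp_all add: omit_def)

text \<open>The bracket stands in place i in the Lie derivative but in front in the
  Chevalley-Eilenberg formula; the sign counts the i entries crossed.\<close>

lemma alternating_form_omit:
  assumes "alternating_form F" "i < length gs"
  shows "scaleM ((-1) ^ i) (F (x # omit i gs)) = F (gs[i := x])"
  using alternating_form_move[OF assms(1), of "[]" "take i gs" x "drop (Suc i) gs"] assms(2)
  by (simp add: omit_def upd_conv_take_nth_drop)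

text \<open>Splitting index 0 off the sums for \<open>x # gs\<close> leaves the terms of L_x F. The
  terms with positive indices form -\<open>cobd\<close> of i_x F: in the single sum the sign comes
  from the index shift, in the double sum from swapping the bracket with x.\<close>

lemma cobd_eq:
  "alternating_form F \<Longrightarrow> cobd F gs =
     (\<Sum>i<length gs. scaleM ((-1) ^ i) (act (gs ! i) (F (omit i gs)))) +
     (\<Sum>j<length gs. \<Sum>i<j. scaleM ((-1) ^ (i + j))
        (F (bracket (gs ! i) (gs ! j) # omit i (omit j gs))))"
proof (induction gs arbitrary: F)
  case (Cons x gs)
  have swap: "F (y # x # zs) = - F (x # y # zs)" for y zs
    using alternating_form_swap[OF Cons.prems, of "[]" y x zs] by simp
  have "(\<Sum>i<length gs. F (gs[i := bracket x (gs ! i)])) =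
      (\<Sum>i<length gs. scaleM ((-1) ^ i) (F (bracket x (gs ! i) # omit i gs)))"
    by (simp add: alternating_form_omit[OF Cons.prems])
  then show ?case
    using Cons.IH[OF alternating_form_insertion[OF Cons.prems], of x]
    by (simp add: lie_deriv_eq swap sum.lessThan_Suc_shift sum.distrib sum_negf
        sum_subtractf del: sum.lessThan_Suc)
qed simp

lemma coboundary_eq_cobd:
  assumes "F \<in> cochains scale scaleM n"
  shows "coboundary bracket scaleM act n F = cobd F"
proof
  fix gs
  have F: "alternating_form F" "\<And>zs. length zs \<noteq> n \<Longrightarrow> F zs = 0"
    using assms by (auto simp: cochains_iff_alternating_form)
  show "coboundary bracket scaleM act n F gs = cobd F gs"
  proof (cases "length gs = Suc n")
    case True
    then show ?thesis
      by (simp add: coboundary_def cobd_eq[OF F(1)] lessThan_Suc_atMost del: sum.lessThan_Suc)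
  next
    case False
    then show ?thesis using F(2) by (simp add: coboundary_def cobd_eq_0)
  qed
qed

text \<open>The Lie derivative evaluates \<open>F\<close> only on lists of the same length, so it
  vanishes outside degree n and the condition can be stated for all lists.\<close>

lemma weight_zero_iff_lie_deriv:
  assumes "F \<in> cochains scale scaleM n"
  shows "weight_zero bracket act H n F \<longleftrightarrow> (\<forall>h\<in>H. \<forall>gs. lie_deriv h F gs = 0)"
proof -
  have "lie_deriv h F gs = 0" if "length gs \<noteq> n" for h gs
    using assms that by (simp add: lie_deriv_eq cochains_iff_alternating_form act_right.zero)
  moreover have "lie_deriv h F gs = 0 \<longleftrightarrow> act h (F gs) = (\<Sum>i<n. F (gs[i := bracket h (gs ! i)]))"
    if "length gs = n" for h gs
    using that by (simp add: lie_deriv_eq)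
  ultimately show ?thesis
    unfolding weight_zero_def by blast
qed

section \<open>The filtration\<close>

lemma cobd_vanishing:
  assumes comm: "\<And>x y. x \<in> H \<Longrightarrow> y \<in> H \<Longrightarrow> bracket x y = 0"
  shows "alternating_form F \<Longrightarrow> (\<And>h gs. h \<in> H \<Longrightarrow> lie_deriv h F gs = 0) \<Longrightarrow>
    (\<And>gs. r \<le> length (filter (\<lambda>x. x \<in> H) gs) \<Longrightarrow> F gs = 0) \<Longrightarrow>
    r \<le> length (filter (\<lambda>x. x \<in> H) gs) \<Longrightarrow> cobd F gs = 0"
proof (induction r arbitrary: F gs)
  case 0
  \<comment> \<open>For r = 0 the vanishing hypothesis covers every list.\<close>
  then have "F = (\<lambda>_. 0)" by auto
  then show ?case by simp
next
  case (Suc r)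
  have "filter (\<lambda>x. x \<in> H) gs \<noteq> []" using Suc.prems(4) by auto
  then obtain h where "h \<in> set gs" and h: "h \<in> H" by (auto simp: filter_empty_conv)
  then obtain ps qs where gs: "gs = ps @ h # qs" by (auto simp: in_set_conv_decomp)
  let ?G = "\<lambda>zs. F (h # zs)"
  have "cobd ?G (ps @ qs) = 0"
  proof (rule Suc.IH)
    show "alternating_form ?G" by (rule alternating_form_insertion[OF Suc.prems(1)])
    \<comment> \<open>L_h' i_h F = i_h L_h' F + i_[h',h] F, and [h', h] = 0.\<close>
    show "lie_deriv h' ?G zs = 0" if "h' \<in> H" for h' zs
      using Suc.prems(2)[OF that, of "h # zs"] comm[OF that h] Suc.prems(1)
      by (simp add: alternating_form_Cons[OF Suc.prems(1)])
    show "?G zs = 0" if "r \<le> length (filter (\<lambda>x. x \<in> H) zs)" for zs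
      by (rule Suc.prems(3)) (use that h in simp)
    show "r \<le> length (filter (\<lambda>x. x \<in> H) (ps @ qs))" using Suc.prems(4) h by (simp add: gs)
  qed
  then have "cobd F (h # ps @ qs) = 0" by (simp add: Suc.prems(2)[OF h])
  then show ?case
    using alternating_form_move[OF alternating_form_cobd[OF Suc.prems(1)], of "[]" ps h qs]
    by (simp add: gs)
qed

text \<open>Counting with \<open>filter\<close> instead of positions suits the induction: the count
  drops by exactly one when an element of \<open>H\<close> is taken out of the list.\<close>

lemma filtered_cochains_iff:
  "F \<in> filtered_cochains scale bracket scaleM act H r n \<longleftrightarrow>
     F \<in> cochains scale scaleM n \<and> (\<forall>h\<in>H. \<forall>gs. lie_deriv h F gs = 0) \<and>
     (\<forall>gs. r \<le> length (filter (\<lambda>x. x \<in> H) gs) \<longrightarrow> F gs = 0)"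
proof (cases "F \<in> cochains scale scaleM n")
  case True
  then have "(length gs = n \<longrightarrow> r \<le> card {i. i < n \<and> gs ! i \<in> H} \<longrightarrow> F gs = 0) \<longleftrightarrow>
      (r \<le> length (filter (\<lambda>x. x \<in> H) gs) \<longrightarrow> F gs = 0)" for gs
    by (cases "length gs = n") (auto simp: cochains_iff_alternating_form length_filter_conv_card)
  then show ?thesis
    using True by (simp add: filtered_cochains_def weight_zero_iff_lie_deriv)
qed (simp add: filtered_cochains_def)

lemma coboundary_filtered_cochains:
  assumes "\<And>x y. x \<in> H \<Longrightarrow> y \<in> H \<Longrightarrow> bracket x y = 0"
    and "F \<in> filtered_cochains scale bracket scaleM act H r n"
  shows "coboundary bracket scaleM act n F \<in> filtered_cochains scale bracket scaleM act H r (Suc n)"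
proof -
  have F: "F \<in> cochains scale scaleM n" "\<And>h gs. h \<in> H \<Longrightarrow> lie_deriv h F gs = 0"
    "\<And>gs. r \<le> length (filter (\<lambda>x. x \<in> H) gs) \<Longrightarrow> F gs = 0"
    using assms(2) by (auto simp: filtered_cochains_iff)
  have alt: "alternating_form F" and F0: "\<And>gs. length gs \<noteq> n \<Longrightarrow> F gs = 0"
    using F(1) by (auto simp: cochains_iff_alternating_form)
  have "cobd F \<in> cochains scale scaleM (Suc n)"
    using alternating_form_cobd[OF alt] F0 by (auto simp: cochains_iff_alternating_form cobd_eq_0)
  \<comment> \<open>Weight zero: \<open>cobd\<close> commutes with L_h, and L_h F = 0.\<close>
  moreover have "lie_deriv h (cobd F) gs = 0" if "h \<in> H" for h gs
    unfolding lie_deriv_cobd[OF alt] by (rule cobd_eq_0) (rule F(2)[OF that])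
  moreover have "cobd F gs = 0" if "r \<le> length (filter (\<lambda>x. x \<in> H) gs)" for gs
    by (rule cobd_vanishing[OF assms(1) alt F(2,3) that])
  ultimately show ?thesis
    by (simp add: coboundary_eq_cobd[OF F(1)] filtered_cochains_iff)
qed

end

theorem mainTheorem5:
  fixes scale :: "'k::field \<Rightarrow> 'g::ab_group_add \<Rightarrow> 'g"
    and bracket :: "'g \<Rightarrow> 'g \<Rightarrow> 'g"
    and scaleM :: "'k \<Rightarrow> 'm::ab_group_add \<Rightarrow> 'm"
    and act :: "'g \<Rightarrow> 'm \<Rightarrow> 'm"
    and H :: "'g set"
    and n r :: nat
  assumes "lie_algebra scale bracket"
    and "toral_subalgebra scale bracket H"
    and "lie_module scale bracket scaleM act"
    and "acts_torally scaleM act H"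
  shows "coboundary bracket scaleM act n ` filtered_cochains scale bracket scaleM act H r n
           \<subseteq> filtered_cochains scale bracket scaleM act H r (Suc n)"
  using lie_module.coboundary_filtered_cochains[OF assms(3)] assms(2)
  by (auto simp: toral_subalgebra_def)

end
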